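(* Let $\mathcal{X}$ be a real or complex Banach space and let $L_0\in\mathcal{B}(\mathcal{X})$ have a simple isolated eigenvalue $\lambda_0$, with condition number $\tau_0:=\tau_{L_0}$ and spectral isolation $\gamma_0:=\gamma_{L_0}$. Then every $L\in\mathcal{B}(\mathcal{X})$ with $\|L-L_0\|<\frac{1}{6\tau_0\gamma_0}$ has an ASIE. More precisely, there is an analytic map $L\mapsto\lambda_L$ on the open ball $B\big(L_0,\frac{1}{6\tau_0\gamma_0}\big)\subset\mathcal{B}(\mathcal{X})$ with $\lambda_{L_0}=\lambda_0$ such that $\lambda_L$ is a simple isolated eigenvalue of $L$ for every $L$ in this ball.
   Context: $\mathcal{X}$ is a real or complex Banach space with scalar field $\mathbb{K}$. $\mathcal{B}(\mathcal{X})$ denotes the bounded linear operators on $\mathcal{X}$ with the operator norm. $\mathcal{X}^*$ consists of the bounded linear (not semilinear) forms. An operator $L$ has $\lambda\in\mathbb{K}$ as a simple isolated eigenvalue if there are a nonzero $u\in\mathcal{X}$ with $Lu=\lambda u$ and a closed complement $G$ of $\langle u\rangle$ with $L(G)\subset G$ such that $(L-\lambda)|_G:G\to G$ is invertible with bounded inverse. In that case there is an eigenform $\phi\in\mathcal{X}^*$ with $\phi\circ L=\lambda\phi$ and $\ker\phi=G$; normalize it so that $\phi(u)=1$. Set $P_L=\phi(\cdot)u$ (the rank-one operator $x\mapsto\phi(x)u$), $\pi_L=\mathrm{Id}-P_L$, and define the reduced resolvent $S_L=(L-\lambda)|_G^{-1}\circ\pi_L\in\mathcal{B}(\mathcal{X})$.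 The condition number is $\tau_L=\frac{\|\phi\|\|u\|}{|\phi(u)|}=\|P_L\|$ and the spectral isolation is $\gamma_L=\|S_L\|$. Every $L$ in an open connected set $\mathcal{V}\ni L_0$ is said to have an ASIE (analytic simple isolated eigenvalue) if there is an analytic map $\lambda:\mathcal{V}\to\mathbb{K}$ (analytic in the sense of locally convergent power series of bounded symmetric multilinear maps) with $\lambda_{L_0}=\lambda_0$ such that $\lambda_L$ is a simple isolated eigenvalue of $L$ for every $L\in\mathcal{V}$. *)

theory Defs
  imports "HOL-Analysis.Analysis"
begin

text \<open>Scalar field: a type 'k of class real_normed_field + banach (in practice
  real or complex).  The Banach space is a type 'a of class banach (a real Banach
  space) together with a scalar multiplication sm by 'k that extends the real one
  and is norm-compatible.  For the real case take 'k = real and sm = scaleR.\<close>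

definition K_structure :: "('k::{real_normed_field,banach} \<Rightarrow> 'a::banach \<Rightarrow> 'a) \<Rightarrow> bool" where
  "K_structure sm \<longleftrightarrow>
     (\<forall>x. sm 1 x = x) \<and>
     (\<forall>a b x. sm (a * b) x = sm a (sm b x)) \<and>
     (\<forall>a b x. sm (a + b) x = sm a x + sm b x) \<and>
     (\<forall>a x y. sm a (x + y) = sm a x + sm a y) \<and>
     (\<forall>r x. sm (of_real r) x = r *\<^sub>R x) \<and>
     (\<forall>a x. norm (sm a x) = norm a * norm x)"

definition K_ops :: "('k::{real_normed_field,banach} \<Rightarrow> 'a::banach \<Rightarrow> 'a) \<Rightarrow> ('a \<Rightarrow>\<^sub>L 'a) set" where
  "K_ops sm = {L. \<forall>c x. blinfun_apply L (sm c x) = sm c (blinfun_apply L x)}"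

definition K_subspace :: "('k::{real_normed_field,banach} \<Rightarrow> 'a::banach \<Rightarrow> 'a) \<Rightarrow> 'a set \<Rightarrow> bool" where
  "K_subspace sm G \<longleftrightarrow> 0 \<in> G \<and> (\<forall>x\<in>G. \<forall>y\<in>G. x + y \<in> G) \<and> (\<forall>c. \<forall>x\<in>G. sm c x \<in> G)"

definition sie_data :: "('k::{real_normed_field,banach} \<Rightarrow> 'a::banach \<Rightarrow> 'a) \<Rightarrow> ('a \<Rightarrow>\<^sub>L 'a) \<Rightarrow> 'k \<Rightarrow> 'a \<Rightarrow> 'a set \<Rightarrow> bool" where
  "sie_data sm L lam u G \<longleftrightarrow>
     u \<noteq> 0 \<and> blinfun_apply L u = sm lam u \<and>
     K_subspace sm G \<and> closed G \<and>
     (\<forall>x. \<exists>c. \<exists>g\<in>G. x = sm c u + g) \<and>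
     (\<forall>c. sm c u \<in> G \<longrightarrow> c = 0) \<and>
     blinfun_apply L ` G \<subseteq> G \<and>
     bij_betw (\<lambda>x. blinfun_apply L x - sm lam x) G G \<and>
     (\<exists>C. \<forall>g\<in>G. norm g \<le> C * norm (blinfun_apply L g - sm lam g))"

definition simple_isolated_eigenvalue :: "('k::{real_normed_field,banach} \<Rightarrow> 'a::banach \<Rightarrow> 'a) \<Rightarrow> ('a \<Rightarrow>\<^sub>L 'a) \<Rightarrow> 'k \<Rightarrow> bool" where
  "simple_isolated_eigenvalue sm L lam \<longleftrightarrow> (\<exists>u G. sie_data sm L lam u G)"

text \<open>Eigenform phi (normalised, phi u = 1, ker phi = G): the u-coordinate w.r.t. the
  decomposition X = <u> + G.  Spectral projection P, reduced resolvent S.\<close>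

definition eigenform :: "('k::{real_normed_field,banach} \<Rightarrow> 'a::banach \<Rightarrow> 'a) \<Rightarrow> 'a \<Rightarrow> 'a set \<Rightarrow> 'a \<Rightarrow> 'k" where
  "eigenform sm u G x = (THE c. \<exists>g\<in>G. x = sm c u + g)"

definition spec_proj :: "('k::{real_normed_field,banach} \<Rightarrow> 'a::banach \<Rightarrow> 'a) \<Rightarrow> 'a \<Rightarrow> 'a set \<Rightarrow> 'a \<Rightarrow> 'a" where
  "spec_proj sm u G x = sm (eigenform sm u G x) u"

definition reduced_resolvent :: "('k::{real_normed_field,banach} \<Rightarrow> 'a::banach \<Rightarrow> 'a) \<Rightarrow> ('a \<Rightarrow>\<^sub>L 'a) \<Rightarrow> 'k \<Rightarrow> 'a \<Rightarrow> 'a set \<Rightarrow> 'a \<Rightarrow> 'a" where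
  "reduced_resolvent sm L lam u G x =
     (THE g. g \<in> G \<and> blinfun_apply L g - sm lam g = x - spec_proj sm u G x)"

definition cond_number :: "('k::{real_normed_field,banach} \<Rightarrow> 'a::banach \<Rightarrow> 'a) \<Rightarrow> 'a \<Rightarrow> 'a set \<Rightarrow> real" where
  "cond_number sm u G = onorm (spec_proj sm u G)"

definition spec_isolation :: "('k::{real_normed_field,banach} \<Rightarrow> 'a::banach \<Rightarrow> 'a) \<Rightarrow> ('a \<Rightarrow>\<^sub>L 'a) \<Rightarrow> 'k \<Rightarrow> 'a \<Rightarrow> 'a set \<Rightarrow> real" where
  "spec_isolation sm L lam u G = onorm (reduced_resolvent sm L lam u G)"

definition bsml_form :: "('k::{real_normed_field,banach} \<Rightarrow> 'a::banach \<Rightarrow> 'a) \<Rightarrow> nat \<Rightarrow> ((nat \<Rightarrow> ('a \<Rightarrow>\<^sub>L 'a)) \<Rightarrow> 'k) \<Rightarrow> bool" where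
  "bsml_form sm n A \<longleftrightarrow>
     (\<forall>v w. (\<forall>i<n. v i = w i) \<longrightarrow> A v = A w) \<and>
     (\<forall>i<n. \<forall>v. (\<forall>j<n. v j \<in> K_ops sm) \<longrightarrow>
        (\<forall>x\<in>K_ops sm. \<forall>y\<in>K_ops sm. A (v(i := x + y)) = A (v(i := x)) + A (v(i := y))) \<and>
        (\<forall>c. \<forall>x\<in>K_ops sm. \<forall>y\<in>K_ops sm.
            (\<forall>z. blinfun_apply y z = sm c (blinfun_apply x z)) \<longrightarrow> A (v(i := y)) = c * A (v(i := x)))) \<and>
     (\<forall>p v. p permutes {..<n} \<longrightarrow> (\<forall>j<n. v j \<in> K_ops sm) \<longrightarrow> A (v \<circ> p) = A v) \<and>
     (\<exists>C. \<forall>v. (\<forall>j<n. v j \<in> K_ops sm) \<longrightarrow> norm (A v) \<le> C * (\<Prod>j<n. norm (v j)))"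

definition ml_norm :: "('k::{real_normed_field,banach} \<Rightarrow> 'a::banach \<Rightarrow> 'a) \<Rightarrow> nat \<Rightarrow> ((nat \<Rightarrow> ('a \<Rightarrow>\<^sub>L 'a)) \<Rightarrow> 'k) \<Rightarrow> real" where
  "ml_norm sm n A = Sup {norm (A v) | v. \<forall>j<n. v j \<in> K_ops sm \<and> norm (v j) \<le> 1}"

definition K_analytic_on :: "('k::{real_normed_field,banach} \<Rightarrow> 'a::banach \<Rightarrow> 'a) \<Rightarrow> ('a \<Rightarrow>\<^sub>L 'a) set \<Rightarrow> (('a \<Rightarrow>\<^sub>L 'a) \<Rightarrow> 'k) \<Rightarrow> bool" where
  "K_analytic_on sm V f \<longleftrightarrow>
     (\<forall>A\<in>V. \<exists>r>0. \<exists>Ps :: nat \<Rightarrow> (nat \<Rightarrow> ('a \<Rightarrow>\<^sub>L 'a)) \<Rightarrow> 'k.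
        (\<forall>n. bsml_form sm n (Ps n)) \<and>
        summable (\<lambda>n. ml_norm sm n (Ps n) * r ^ n) \<and>
        (\<forall>H\<in>K_ops sm. norm H < r \<longrightarrow> A + H \<in> V \<and> (\<lambda>n. Ps n (\<lambda>_. H)) sums f (A + H)))"

end

theory Submission
  imports Defs
begin

text \<open>
  Write the eigenvector of \<open>L + H\<close> as \<open>u + w\<close> with \<open>w\<close> in \<open>G\<close>. Applying the eigenform \<open>phi\<close> and the
  reduced resolvent \<open>S\<close> to the eigenvalue equation shows that it is equivalent to the fixed-point
  equation \<open>w = S (phi (H (u + w)) w - H (u + w))\<close> together with eigenvalue
  \<open>lam + phi (H (u + w))\<close>. When \<open>6 \<tau> \<gamma> \<parallel>H\<parallel> < 1\<close> the right-hand side maps the ball of radius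
  \<open>\<parallel>u\<parallel> / \<tau>\<close> of \<open>G\<close> to itself and contracts it by the factor \<open>2/3\<close>. The same contraction bound on
  the derivative makes \<open>L + H - \<mu>\<close> invertible modulo the new eigenvector, so the eigenvalue \<open>\<mu>\<close> is again
  simple and isolated. Analyticity is local: for small \<open>H\<close> the fixed point is a
  power series in \<open>H\<close> whose coefficients have a Catalan-type majorant. Since the eigenvalue is simple
  and isolated at every point of the ball, this series can be used at each of these points, and
  uniqueness of the fixed point identifies its sum with the eigenvalue.
\<close>

section \<open>Cauchy products under a bounded bilinear map\<close>

text \<open>Partial sums over squares of index pairs converge to \<open>prod s t\<close>; the Cauchy
  partial sums run over triangles. The gap is at most \<open>K\<close> times the same gap for the
  series of norms, which vanishes by the real Cauchy product theorem.\<close>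

lemma (in bounded_bilinear) Cauchy_product_sums:
  assumes a: "summable (\<lambda>n. norm (a n))" and b: "summable (\<lambda>n. norm (b n))"
    and sa: "a sums s" and sb: "b sums t"
  shows "(\<lambda>n. \<Sum>i\<le>n. prod (a i) (b (n - i))) sums prod s t"
proof -
  let ?D = "\<lambda>n::nat. {..<n} \<times> {..<n}" and ?T = "\<lambda>n::nat. {(i, j). i + j < n}"
  let ?g = "\<lambda>(i, j). prod (a i) (b j)" and ?f = "\<lambda>(i, j). norm (a i) * norm (b j)"
  have TD: "?T n \<subseteq> ?D n" for n by auto
  obtain K where K: "0 \<le> K" "\<And>x y. norm (prod x y) \<le> norm x * norm y * K"
    using nonneg_bounded by blast
  have g_tri: "(\<Sum>k<n. \<Sum>i\<le>k. prod (a i) (b (k - i))) = sum ?g (?T n)" for n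
    by (subst sum.triangle_reindex[symmetric]) (auto intro: sum.cong)
  have f_tri: "(\<Sum>k<n. \<Sum>i\<le>k. norm (a i) * norm (b (k - i))) = sum ?f (?T n)" for n
    by (subst sum.triangle_reindex[symmetric]) (auto intro: sum.cong)
  have g_sq: "prod (\<Sum>k<n. a k) (\<Sum>k<n. b k) = sum ?g (?D n)" for n
    unfolding sum_left sum_right by (subst sum.swap) (rule sum.cartesian_product)
  have f_sq: "(\<Sum>k<n. norm (a k)) * (\<Sum>k<n. norm (b k)) = sum ?f (?D n)" for n
    by (simp add: sum_product sum.cartesian_product)
  have "(\<lambda>n. sum ?f (?D n)) \<longlonglongrightarrow> (\<Sum>k. norm (a k)) * (\<Sum>k. norm (b k))"
    unfolding f_sq[symmetric] by (intro tendsto_mult summable_LIMSEQ a b)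
  moreover have "(\<lambda>n. sum ?f (?T n)) \<longlonglongrightarrow> (\<Sum>k. norm (a k)) * (\<Sum>k. norm (b k))"
    unfolding f_tri[symmetric]
    using Series.Cauchy_product_sums[of "\<lambda>k. norm (a k)" "\<lambda>k. norm (b k)"] a b by (simp add: sums_def)
  ultimately have "(\<lambda>n. K * (sum ?f (?D n) - sum ?f (?T n))) \<longlonglongrightarrow> 0"
    using tendsto_mult[OF tendsto_const tendsto_diff] by fastforce
  moreover have "norm (sum ?g (?D n) - sum ?g (?T n)) \<le> K * (sum ?f (?D n) - sum ?f (?T n))" for n
  proof -
    have "sum ?g (?D n) - sum ?g (?T n) = sum ?g (?D n - ?T n)"
      by (rule sum_diff[symmetric]) (use TD in auto)
    moreover have "norm (sum ?g (?D n - ?T n)) \<le> (\<Sum>p\<in>?D n - ?T n. K * ?f p)"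
      by (rule sum_norm_le) (use K in \<open>auto simp: mult.commute\<close>)
    moreover have "sum ?f (?D n - ?T n) = sum ?f (?D n) - sum ?f (?T n)"
      by (rule sum_diff) (use TD in auto)
    ultimately show ?thesis by (simp add: sum_distrib_left[symmetric])
  qed
  ultimately have "(\<lambda>n. sum ?g (?D n) - sum ?g (?T n)) \<longlonglongrightarrow> 0"
    by (metis (no_types, lifting) Lim_null_comparison always_eventually)
  moreover have "(\<lambda>n. sum ?g (?D n)) \<longlonglongrightarrow> prod s t"
    unfolding g_sq[symmetric] using sa sb by (intro tendsto) (simp_all add: sums_def)
  ultimately have "(\<lambda>n. sum ?g (?T n)) \<longlonglongrightarrow> prod s t"
    using tendsto_diff by fastforce
  then show ?thesis unfolding sums_def g_tri .
qed

section \<open>Simple isolated eigenvalues\<close>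

locale K_space =
  fixes sm :: "'k::{real_normed_field,banach} \<Rightarrow> 'a::banach \<Rightarrow> 'a"
  assumes K_structure: "K_structure sm"
begin

lemma sm_one [simp]: "sm 1 x = x"
  and sm_assoc [simp]: "sm a (sm b x) = sm (a * b) x"
  and sm_add_left: "sm (a + b) x = sm a x + sm b x"
  and sm_add_right: "sm a (x + y) = sm a x + sm a y"
  and sm_of_real: "sm (of_real r) x = r *\<^sub>R x"
  and norm_sm [simp]: "norm (sm a x) = norm a * norm x"
  using K_structure by (auto simp: K_structure_def)

lemma bounded_bilinear_sm: "bounded_bilinear sm"
proof
  fix r a b
  show "sm (r *\<^sub>R a) b = r *\<^sub>R sm a b"
    by (simp add: scaleR_conv_of_real flip: sm_of_real)
  show "sm a (r *\<^sub>R b) = r *\<^sub>R sm a b"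
    by (simp add: mult.commute flip: sm_of_real)
  show "\<exists>K. \<forall>a b. norm (sm a b) \<le> norm a * norm b * K"
    by (rule exI[of _ 1]) simp
qed (simp_all add: sm_add_left sm_add_right)

sublocale sm: bounded_bilinear sm by (rule bounded_bilinear_sm)

declare sm.zero_left [simp] sm.zero_right [simp]

lemma sm_eq_0 [simp]: "sm c x = 0 \<longleftrightarrow> c = 0 \<or> x = 0"
  using norm_sm[of c x] by (metis mult_eq_0_iff norm_eq_zero)

lemma K_ops_apply: "L \<in> K_ops sm \<Longrightarrow> L (sm c x) = sm c (L x)"
  by (simp add: K_ops_def)

lemma K_ops_add [intro]: "L \<in> K_ops sm \<Longrightarrow> M \<in> K_ops sm \<Longrightarrow> L + M \<in> K_ops sm"
  and K_ops_diff [intro]: "L \<in> K_ops sm \<Longrightarrow> M \<in> K_ops sm \<Longrightarrow> L - M \<in> K_ops sm"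
  and K_ops_zero [intro]: "0 \<in> K_ops sm"
  by (auto simp: K_ops_def blinfun.add_left blinfun.diff_left sm_add_right sm.diff_right)

lemma K_subspace_minus: "K_subspace sm G \<Longrightarrow> x \<in> G \<Longrightarrow> - x \<in> G"
  using sm.minus_left[of 1 x] unfolding K_subspace_def by (metis sm_one)

lemma K_subspace_diff: "K_subspace sm G \<Longrightarrow> x \<in> G \<Longrightarrow> y \<in> G \<Longrightarrow> x - y \<in> G"
  using K_subspace_minus[of G y] unfolding K_subspace_def by (metis add_uminus_conv_diff)

end

section \<open>Eigenform and reduced resolvent\<close>

locale sie = K_space sm
  for sm :: "'k::{real_normed_field,banach} \<Rightarrow> 'a::banach \<Rightarrow> 'a" +
  fixes L :: "'a \<Rightarrow>\<^sub>L 'a" and lam :: 'k and u :: 'a and G :: "'a set"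
  assumes L_K_ops: "L \<in> K_ops sm" and sie_data: "sie_data sm L lam u G"
begin

abbreviation phi where "phi \<equiv> eigenform sm u G"
abbreviation S where "S \<equiv> reduced_resolvent sm L lam u G"

lemma u_neq_0: "u \<noteq> 0" and L_u: "L u = sm lam u" and closed_G: "closed G"
  and subspace_G: "K_subspace sm G"
  using sie_data by (auto simp: sie_data_def)

lemma G_zero [intro, simp]: "0 \<in> G"
  and G_add [intro]: "x \<in> G \<Longrightarrow> y \<in> G \<Longrightarrow> x + y \<in> G"
  and G_sm [intro]: "x \<in> G \<Longrightarrow> sm c x \<in> G"
  and G_diff [intro]: "x \<in> G \<Longrightarrow> y \<in> G \<Longrightarrow> x - y \<in> G"
  using subspace_G K_subspace_diff[OF subspace_G] by (auto simp: K_subspace_def)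

lemma G_L [intro]: "x \<in> G \<Longrightarrow> L x \<in> G"
  using sie_data by (auto simp: sie_data_def)

lemma sm_u_in_G: "sm c u \<in> G \<longleftrightarrow> c = 0"
  using sie_data by (auto simp: sie_data_def)

lemma phi_eqI: assumes "x - sm c u \<in> G" shows "phi x = c"
  unfolding eigenform_def
proof (rule the_equality)
  show "\<exists>g\<in>G. x = sm c u + g"
    using assms by (intro bexI[of _ "x - sm c u"]) auto
  fix d assume "\<exists>g\<in>G. x = sm d u + g"
  then have "x - sm d u \<in> G" by auto
  then have "(x - sm c u) - (x - sm d u) \<in> G" using assms by blast
  then have "sm (d - c) u \<in> G" by (simp add: sm.diff_left)
  then show "d = c" using sm_u_in_G by auto
qed

lemma compl_in_G: "x - sm (phi x) u \<in> G"
proof -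
  obtain c g where "g \<in> G" "x = sm c u + g"
    using sie_data unfolding sie_data_def by meson
  then have "x - sm c u \<in> G" by auto
  then show ?thesis using phi_eqI by auto
qed

lemma phi_add: "phi (x + y) = phi x + phi y"
proof (rule phi_eqI)
  have "(x - sm (phi x) u) + (y - sm (phi y) u) \<in> G" using compl_in_G by blast
  then show "x + y - sm (phi x + phi y) u \<in> G" by (simp add: sm.add_left algebra_simps)
qed

lemma phi_sm: "phi (sm c x) = c * phi x"
proof (rule phi_eqI)
  have "sm c (x - sm (phi x) u) \<in> G" using compl_in_G by blast
  then show "sm c x - sm (c * phi x) u \<in> G" by (simp add: sm.diff_right)
qed

lemma phi_u [simp]: "phi u = 1"
  by (rule phi_eqI) simp

lemma phi_eq_0_iff: "phi x = 0 \<longleftrightarrow> x \<in> G"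
  using phi_eqI[of x 0] compl_in_G[of x] by auto

text \<open>Continuity comes from the closed kernel: \<open>u\<close> has a positive distance
  \<open>d\<close> from \<open>G\<close>, and if \<open>phi x\<close> is nonzero then
  \<open>u - x / phi x\<close> lies in \<open>G\<close>, so
  \<open>d <= norm x / norm (phi x)\<close>.\<close>

lemma bounded_linear_phi: "bounded_linear phi"
proof -
  have "open (- G)" "u \<in> - G" using closed_G sm_u_in_G[of 1] by auto
  then obtain d where d: "d > 0" "ball u d \<subseteq> - G" by (meson openE)
  have "norm (phi x) \<le> norm x * (1 / d)" for x
  proof (cases "phi x = 0")
    case False
    have "sm (- inverse (phi x)) (x - sm (phi x) u) \<in> G" using compl_in_G by blast
    then have "u - sm (inverse (phi x)) x \<in> G"
      using False by (simp add: sm.diff_right sm.minus_left)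
    then have "u - sm (inverse (phi x)) x \<notin> ball u d" using d by blast
    then have "d \<le> norm x / norm (phi x)" 
      by (simp add: dist_norm norm_inverse divide_inverse mult.commute not_less)
    then show ?thesis using False d by (simp add: field_simps)
  qed (use d in simp)
  moreover have "phi (r *\<^sub>R x) = r *\<^sub>R phi x" for r x
    using phi_sm[of "of_real r" x] by (simp add: sm_of_real scaleR_conv_of_real)
  ultimately show ?thesis by (intro bounded_linear_intro phi_add)
qed

sublocale phi: bounded_linear phi by (rule bounded_linear_phi)

lemma phi_L: "phi (L x) = lam * phi x"
proof (rule phi_eqI)
  have "L (x - sm (phi x) u) \<in> G" using compl_in_G by blast
  then show "L x - sm (lam * phi x) u \<in> G"
    by (simp add: blinfun.diff_right K_ops_apply[OF L_K_ops] L_u mult.commute)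
qed

lemma S_spec: "S x \<in> G \<and> L (S x) - sm lam (S x) = x - sm (phi x) u"
proof -
  let ?T = "\<lambda>x. L x - sm lam x"
  have "bij_betw ?T G G" using sie_data unfolding sie_data_def by blast
  then have inj: "inj_on ?T G" and im: "?T ` G = G" by (auto simp only: bij_betw_def)
  have "x - sm (phi x) u \<in> ?T ` G" unfolding im by (rule compl_in_G)
  then obtain g where g: "g \<in> G" "?T g = x - sm (phi x) u" by (elim imageE) simp
  have "\<exists>!g. g \<in> G \<and> L g - sm lam g = x - sm (phi x) u"
  proof (rule ex1I[of _ g])
    fix h assume "h \<in> G \<and> L h - sm lam h = x - sm (phi x) u"
    with g show "h = g" using inj_onD[OF inj, of h g] by simp
  qed (use g in simp)
  then show ?thesis
    unfolding reduced_resolvent_def spec_proj_def by (rule theI')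
qed

lemma S_in_G [intro, simp]: "S x \<in> G" and L_S: "L (S x) = sm lam (S x) + x - sm (phi x) u"
  using S_spec[of x] by (auto simp: algebra_simps)

lemma S_eqI: assumes "g \<in> G" "L g - sm lam g = x - sm (phi x) u" shows "S x = g"
proof -
  have "inj_on (\<lambda>x. L x - sm lam x) G" using sie_data unfolding sie_data_def bij_betw_def by blast
  then show ?thesis using assms S_spec[of x] by (simp add: inj_on_def)
qed

lemma S_inverse: "g \<in> G \<Longrightarrow> S (L g - sm lam g) = g"
  by (rule S_eqI) (auto simp: phi_L phi.diff phi_sm)

lemma S_u [simp]: "S u = 0"
  by (rule S_eqI) auto

lemma S_add: "S (x + y) = S x + S y"
proof (rule S_eqI)
  show "L (S x + S y) - sm lam (S x + S y) = x + y - sm (phi (x + y)) u"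
    using L_S[of x] L_S[of y] by (simp add: blinfun.add_right phi_add sm_add_left sm_add_right)
qed auto

lemma S_sm: "S (sm c x) = sm c (S x)"
proof (rule S_eqI)
  show "L (sm c (S x)) - sm lam (sm c (S x)) = sm c x - sm (phi (sm c x)) u"
    by (simp add: K_ops_apply[OF L_K_ops] L_S phi_sm sm_add_right sm.diff_right mult.commute)
qed auto

lemma bounded_linear_S: "bounded_linear S"
proof -
  obtain C where C: "\<And>g. g \<in> G \<Longrightarrow> norm g \<le> C * norm (L g - sm lam g)"
    using sie_data unfolding sie_data_def by meson
  obtain K where K: "\<And>x. norm (phi x) \<le> norm x * K" using phi.bounded by blast
  have "norm (S x) \<le> norm x * (\<bar>C\<bar> * (1 + K * norm u))" for x
  proof -
    have "norm (S x) \<le> C * norm (x - sm (phi x) u)" using C[of "S x"] S_spec[of x] by simp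
    also have "\<dots> \<le> \<bar>C\<bar> * norm (x - sm (phi x) u)" by (intro mult_right_mono) auto
    also have "\<dots> \<le> \<bar>C\<bar> * (norm x + (norm x * K) * norm u)"
      using norm_triangle_ineq4[of x "sm (phi x) u"] mult_right_mono[OF K[of x] norm_ge_zero[of u]]
      by (intro mult_left_mono) auto
    finally show ?thesis by (simp add: algebra_simps)
  qed
  moreover have "S (r *\<^sub>R x) = r *\<^sub>R S x" for r x
    using S_sm[of "of_real r" x] by (simp add: sm_of_real)
  ultimately show ?thesis by (intro bounded_linear_intro S_add)
qed

sublocale S: bounded_linear S by (rule bounded_linear_S)

declare S.zero [simp] phi.zero [simp]

text \<open>The condition number is the norm of a rank-one projection, so it controls
  \<open>phi\<close> only through the product with \<open>norm u\<close>, which does not change when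
  \<open>u\<close> is rescaled.\<close>

lemma norm_phi_le: "norm (phi x) * norm u \<le> cond_number sm u G * norm x"
proof -
  have "bounded_linear (\<lambda>x. sm (phi x) u)"
    by (rule bounded_linear_compose[OF sm.bounded_linear_left bounded_linear_phi])
  from onorm[OF this, of x] show ?thesis by (simp add: cond_number_def spec_proj_def[abs_def])
qed

lemma norm_S_le: "norm (S x) \<le> spec_isolation sm L lam u G * norm x"
  unfolding spec_isolation_def by (rule onorm[OF bounded_linear_S])

lemma cond_number_ge_1: "cond_number sm u G \<ge> 1"
  using norm_phi_le[of u] u_neq_0 by simp

lemma spec_isolation_nonneg: "spec_isolation sm L lam u G \<ge> 0"
  unfolding spec_isolation_def by (rule onorm_pos_le[OF bounded_linear_S])

end

section \<open>Perturbation by a contraction\<close>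

context sie
begin

text \<open>With \<open>x = u + w\<close> the eigenvalue equation reads
  \<open>(L - lam) w = phi (H x) x - H x\<close>. Since \<open>S u = 0\<close>, the vector
  \<open>x\<close> in the first term may be replaced by \<open>w\<close>.\<close>

definition pert_map :: "('a \<Rightarrow>\<^sub>L 'a) \<Rightarrow> 'a \<Rightarrow> 'a" where
  "pert_map H w = S (sm (phi (H (u + w))) w - H (u + w))"

lemma eigenvalue_eq:
  assumes "w \<in> G" "(L + H) (u + w) = sm \<mu> (u + w)"
  shows "\<mu> = lam + phi (H (u + w))"
proof -
  have "phi w = 0" using assms(1) by (simp add: phi_eq_0_iff)
  then show ?thesis
    using arg_cong[OF assms(2), of phi] by (simp add: blinfun.add_left phi_add phi_L phi_sm)
qed

text \<open>For \<open>w\<close> in \<open>G\<close>, \<open>S y = w\<close> means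
  \<open>(L - lam) w = y - phi y u\<close>. Here \<open>phi y = - phi (H x)\<close>, which restores
  the multiple of \<open>u\<close> that \<open>S\<close> had removed.\<close>

lemma pert_map_fixed_iff:
  assumes w: "w \<in> G"
  shows "pert_map H w = w \<longleftrightarrow> (L + H) (u + w) = sm (lam + phi (H (u + w))) (u + w)"
proof -
  have [simp]: "phi w = 0" using w by (simp add: phi_eq_0_iff)
  define x where "x = u + w"
  define y where "y = sm (phi (H x)) w - H x"
  have phi_y: "phi y = - phi (H x)" by (simp add: y_def phi.diff phi_sm)
  have "pert_map H w = w \<longleftrightarrow> L w - sm lam w = y - sm (phi y) u"
    using S_eqI[OF w, of y] S_spec[of y] by (auto simp: pert_map_def x_def y_def)
  also have "\<dots> \<longleftrightarrow> L w - sm lam w - (y - sm (phi y) u) = 0" by simp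
  also have "L w - sm lam w - (y - sm (phi y) u) = (L + H) x - sm (lam + phi (H x)) x"
    unfolding phi_y unfolding y_def
    by (simp add: x_def blinfun.add_left blinfun.add_right L_u sm_add_left sm_add_right sm.minus_left)
  finally show ?thesis by (simp add: x_def)
qed

text \<open>Modulo \<open>u + w\<close> the operator \<open>L + H - \<mu>\<close> becomes the map \<open>T\<close> on \<open>G\<close>, which factors as
  \<open>L - lam\<close> after the identity minus the derivative of \<open>pert_map H\<close> at \<open>w\<close>. The range of
  \<open>L + H - \<mu>\<close> is then the complement of the perturbed eigenline.\<close>

lemma simple_isolated_eigenvalue_perturb:
  assumes H: "H \<in> K_ops sm" and w: "w \<in> G" and fixed: "pert_map H w = w" and q: "q < 1"
    and contr: "\<And>g. g \<in> G \<Longrightarrow>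
      norm (S (sm (phi (H g)) w + sm (phi (H (u + w))) g - H g)) \<le> q * norm g"
  shows "\<exists>G'. sie_data sm (L + H) (lam + phi (H (u + w))) (u + w) G'"
proof -
  define x where "x = u + w"
  define \<mu> where "\<mu> = lam + phi (H x)"
  define M where "M = L + H"
  define N where "N z = M z - sm \<mu> z" for z
  \<comment> \<open>The multiple of \<open>x\<close> is chosen to land in \<open>G\<close>: on
    \<open>G\<close>, \<open>phi (N g) = phi (H g)\<close>, while \<open>phi x = 1\<close>.\<close>
  define T where "T g = N g - sm (phi (H g)) x" for g
  \<comment> \<open>This is the derivative of \<open>pert_map H\<close> at \<open>w\<close> in the
    direction \<open>g\<close>.\<close>
  define D where "D g = S (sm (phi (H g)) w + sm (phi (H x)) g - H g)" for g
  have M_K_ops: "M \<in> K_ops sm" unfolding M_def using L_K_ops H by blast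
  have phi_G: "phi g = 0" if "g \<in> G" for g using that by (simp add: phi_eq_0_iff)
  have phi_x: "phi x = 1" using phi_G[OF w] by (simp add: x_def phi_add)
  have x_neq_0: "x \<noteq> 0" using phi_x by auto
  have M_x: "M x = sm \<mu> x"
    using fixed pert_map_fixed_iff[OF w, of H] by (simp add: M_def \<mu>_def x_def)
  have bl_N: "bounded_linear N"
    unfolding N_def[abs_def]
    by (intro bounded_linear_sub blinfun.bounded_linear_right sm.bounded_linear_right)
  interpret N: bounded_linear N by (rule bl_N)
  have N_x: "N x = 0" by (simp add: N_def M_x)
  have N_sm: "N (sm c z) = sm c (N z)" for c z
    by (simp add: N_def K_ops_apply[OF M_K_ops] sm.diff_right mult.commute)
  have bl_D: "bounded_linear D"
    unfolding D_def[abs_def]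
    by (intro bounded_linear_compose[OF bounded_linear_S] bounded_linear_sub bounded_linear_add
        bounded_linear_compose[OF sm.bounded_linear_left] bounded_linear_compose[OF bounded_linear_phi]
        blinfun.bounded_linear_right sm.bounded_linear_right bounded_linear_ident)
  interpret D: bounded_linear D by (rule bl_D)
  have D_le: "norm (D g) \<le> q * norm g" if "g \<in> G" for g
    using contr[OF that] by (simp add: D_def x_def)
  have phi_N: "phi (N g) = phi (H g)" if "g \<in> G" for g
    using phi_G[OF that] by (simp add: N_def M_def blinfun.add_left phi_add phi.diff phi_L phi_sm)
  have T_G: "T g \<in> G" if "g \<in> G" for g
    using phi_N[OF that] by (simp add: T_def phi.diff phi_sm phi_x flip: phi_eq_0_iff)
  \<comment> \<open>\<open>(L - lam) (D g) = y + phi (H g) u\<close>, and the term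
    \<open>phi (H g) w\<close> inside \<open>y\<close> completes \<open>u\<close> to
    \<open>x\<close>.\<close>
  have T_eq: "T g = L (g - D g) - sm lam (g - D g)" if "g \<in> G" for g
  proof -
    define y where "y = sm (phi (H g)) w + sm (phi (H x)) g - H g"
    have "phi y = - phi (H g)"
      using phi_G[OF that] phi_G[OF w] by (simp add: y_def phi_add phi.diff phi_sm)
    then have "L (D g) = sm lam (D g) + y + sm (phi (H g)) u"
      using L_S[of y] by (simp add: D_def y_def[symmetric] sm.minus_left)
    then show ?thesis
      by (simp add: T_def N_def M_def \<mu>_def y_def blinfun.add_left blinfun.diff_right sm.diff_right
          sm_add_left x_def sm_add_right)
  qed
  have S_T: "S (T g) = g - D g" if "g \<in> G" for g
    unfolding T_eq[OF that] by (rule S_inverse) (use that D_def in auto)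
  obtain C where C: "C > 0" "\<And>z. norm (S z) \<le> norm z * C" using S.pos_bounded by blast
  obtain K where K: "K > 0" "\<And>z. norm (phi z) \<le> norm z * K" using phi.pos_bounded by blast
  obtain CN where CN: "CN > 0" "\<And>z. norm (N z) \<le> norm z * CN" using N.pos_bounded by blast
  have T_below: "norm g \<le> C / (1 - q) * norm (T g)" if "g \<in> G" for g
  proof -
    have "norm g - q * norm g \<le> norm (g - D g)"
      using norm_triangle_ineq2[of g "D g"] D_le[OF that] by simp
    also have "\<dots> \<le> norm (T g) * C" using C(2)[of "T g"] S_T[OF that] by simp
    finally show ?thesis using q by (simp add: field_simps)
  qed
  \<comment> \<open>The correction term is itself bounded by \<open>N g\<close>, because
    \<open>phi (H g) = phi (N g)\<close>. The lower bound for \<open>T\<close> thus passes to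
    \<open>N\<close>, which yields the closed range.\<close>
  have T_N: "norm (T g) \<le> (1 + K * norm x) * norm (N g)" if "g \<in> G" for g
  proof -
    have "norm (T g) \<le> norm (N g) + norm (phi (N g)) * norm x"
      using norm_triangle_ineq4[of "N g" "sm (phi (H g)) x"] phi_N[OF that] by (simp add: T_def)
    also have "\<dots> \<le> norm (N g) + (norm (N g) * K) * norm x"
      by (intro add_left_mono mult_right_mono K) simp
    finally show ?thesis by (simp add: algebra_simps)
  qed
  define c where "c = C / (1 - q) * (1 + K * norm x)"
  have c_pos: "c > 0" unfolding c_def using C K q by (simp add: add_pos_nonneg)
  have N_below: "norm g \<le> c * norm (N g)" if "g \<in> G" for g
  proof -
    have "C / (1 - q) * norm (T g) \<le> C / (1 - q) * ((1 + K * norm x) * norm (N g))"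
      using C q by (intro mult_left_mono T_N that) simp
    then show ?thesis using T_below[OF that] by (simp add: c_def mult.assoc)
  qed
  have T_0: "g = 0" if "g \<in> G" "T g = 0" for g
    using T_below[OF that(1)] that(2) by simp
  have T_surj: "\<exists>g\<in>G. T g = y" if "y \<in> G" for y
  proof -
    \<comment> \<open>By \<open>T_eq\<close> it is enough to solve \<open>g - D g = S y\<close>. The
      contraction constant is \<open>max q 0\<close> since \<open>q\<close> is not assumed to be
      nonnegative.\<close>
    have "\<exists>!g\<in>G. D g + S y = g"
    proof (rule Banach_fix)
      show "complete G" using closed_G by (simp add: complete_eq_closed)
      show "0 \<le> max q 0" "max q 0 < 1" using q by auto
      show "(\<lambda>g. D g + S y) ` G \<subseteq> G" by (auto simp: D_def)
      fix g h assume "g \<in> G" "h \<in> G"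
      then have "norm (D (g - h)) \<le> q * norm (g - h)" by (intro D_le) auto
      also have "\<dots> \<le> max q 0 * norm (g - h)" by (intro mult_right_mono) auto
      finally show "dist (D g + S y) (D h + S y) \<le> max q 0 * dist g h"
        by (simp add: dist_norm D.diff)
    qed auto
    then obtain g where g: "g \<in> G" "D g + S y = g" by blast
    then have "g - D g = S y" by (metis add_diff_cancel_left')
    then have "T g = y" using T_eq[OF g(1)] S_spec[of y] phi_G[OF that] by simp
    with g show ?thesis by blast
  qed
  \<comment> \<open>\<open>N\<close> kills \<open>x\<close>, so on \<open>N\<close> followed by
    \<open>G\<close> its action is conjugate to that of \<open>T\<close>; bijectivity on the image
    follows from that of \<open>T\<close>.\<close>
  have N_T: "N (T g) = N (N g)" for g
    by (simp add: T_def N.diff N_sm N_x)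
  \<comment> \<open>The image of \<open>G\<close> is the whole range of \<open>N\<close>: moving
    \<open>z\<close> into \<open>G\<close> along \<open>x\<close> does not change
    \<open>N z\<close>.\<close>
  have N_img: "N z \<in> N ` G" for z
  proof -
    have "N z = N (z - sm (phi z) x)" by (simp add: N.diff N_sm N_x)
    moreover have "z - sm (phi z) x \<in> G" by (simp add: phi.diff phi_sm phi_x flip: phi_eq_0_iff)
    ultimately show ?thesis by blast
  qed
  have M_N: "M (N z) = N (M z)" for z
    by (simp add: N_def blinfun.diff_right K_ops_apply[OF M_K_ops])
  have "sie_data sm M \<mu> x (N ` G)"
    unfolding sie_data_def
  proof (intro conjI)
    show "K_subspace sm (N ` G)"
      unfolding K_subspace_def
    proof (intro conjI ballI allI)
      show "0 \<in> N ` G" by (rule image_eqI[of _ _ 0]) (auto simp: N.zero)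
    next
      fix a b assume "a \<in> N ` G" "b \<in> N ` G"
      then show "a + b \<in> N ` G" by (auto simp flip: N.add)
    next
      fix c a assume "a \<in> N ` G"
      then show "sm c a \<in> N ` G" by (auto simp flip: N_sm)
    qed
    have "subspace G"
      unfolding subspace_def using G_zero G_add G_sm by (metis sm_of_real)
    then have "complete (N ` G)"
      using complete_isometric_image[of "1 / c" G N] c_pos N_below closed_G bl_N
      by (simp add: complete_eq_closed pos_divide_le_eq mult.commute)
    then show "closed (N ` G)" by (simp add: complete_eq_closed)
    show "\<forall>y. \<exists>c. \<exists>g\<in>N ` G. y = sm c x + g"
    proof
      fix y
      have "y - sm (phi y) x \<in> G" by (simp add: phi.diff phi_sm phi_x flip: phi_eq_0_iff)
      from T_surj[OF this] obtain g where g: "g \<in> G" "T g = y - sm (phi y) x" by blast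
      then have "y = sm (phi y - phi (H g)) x + N g"
        by (simp add: T_def sm.diff_left algebra_simps)
      with g(1) show "\<exists>c. \<exists>g\<in>N ` G. y = sm c x + g" by blast
    qed
    show "\<forall>c. sm c x \<in> N ` G \<longrightarrow> c = 0"
    proof (intro allI impI)
      fix c assume "sm c x \<in> N ` G"
      then obtain g where g: "g \<in> G" "N g = sm c x" by auto
      have "T g = sm (c - phi (H g)) x" using g by (simp add: T_def sm.diff_left)
      moreover have "phi (T g) = 0" using T_G[OF g(1)] phi_G by blast
      ultimately have "T g = 0" by (simp add: phi_sm phi_x)
      then have "g = 0" using T_0 g by blast
      then show "c = 0" using g x_neq_0 by (simp add: N.zero)
    qed
    show "M ` (N ` G) \<subseteq> N ` G" using M_N N_img by auto
    show "bij_betw (\<lambda>z. M z - sm \<mu> z) (N ` G) (N ` G)"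
      unfolding N_def[symmetric] bij_betw_def
    proof
      show "inj_on N (N ` G)"
      proof (rule inj_onI, clarify)
        fix g h assume gh: "g \<in> G" "h \<in> G" and "N (N g) = N (N h)"
        then have "N (T (g - h)) = 0" by (simp add: N_T N.diff)
        then have "T (g - h) = 0" using N_below[OF T_G[of "g - h"]] gh by auto
        then show "N g = N h" using T_0[of "g - h"] gh by auto
      qed
      show "N ` (N ` G) = N ` G"
      proof
        show "N ` (N ` G) \<subseteq> N ` G" using N_img by auto
        show "N ` G \<subseteq> N ` (N ` G)"
        proof clarify
          fix g assume "g \<in> G"
          then obtain h where "h \<in> G" "T h = g" using T_surj by blast
          then show "N g \<in> N ` (N ` G)" using N_T[of h] by auto
        qed
      qed
    qed
    show "\<exists>C. \<forall>g\<in>N ` G. norm g \<le> C * norm (M g - sm \<mu> g)"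
    proof (intro exI ballI)
      fix y assume "y \<in> N ` G"
      then obtain g where g: "g \<in> G" "y = N g" by blast
      \<comment> \<open>Up to constants, \<open>N g\<close> is bounded by \<open>g\<close>, then by
        \<open>T g\<close>, then by \<open>N (T g) = N (N g)\<close>.\<close>
      have "norm (N g) \<le> norm g * CN" by (rule CN)
      also have "\<dots> \<le> (C / (1 - q) * norm (T g)) * CN"
        by (intro mult_right_mono T_below g) (use CN in simp)
      also have "\<dots> \<le> (C / (1 - q) * (c * norm (N (T g)))) * CN"
        using C CN q by (intro mult_right_mono mult_left_mono N_below T_G g) auto
      finally show "norm y \<le> (C / (1 - q) * c * CN) * norm (M y - sm \<mu> y)"
        using N_T[of g] by (simp add: g N_def[symmetric] mult_ac)
    qed
  qed (use x_neq_0 M_x in auto)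
  then show ?thesis by (auto simp: x_def M_def \<mu>_def)
qed

section \<open>Norm estimates and the fixed point\<close>

text \<open>The choice ensures that \<open>phi y\<close> times a vector of norm at most
  \<open>radius\<close> has norm at most \<open>norm y\<close>.\<close>

abbreviation radius :: real where "radius \<equiv> norm u / cond_number sm u G"

text \<open>The multiplied-out form also covers spectral isolation 0, which occurs when
  \<open>G\<close> is trivial; then every \<open>H\<close> is in range.\<close>

abbreviation in_range :: "('a \<Rightarrow>\<^sub>L 'a) \<Rightarrow> bool" where
  "in_range H \<equiv> 6 * cond_number sm u G * spec_isolation sm L lam u G * norm H < 1"

lemma radius_bounds: "0 < radius" "radius \<le> norm u"
proof -
  show "0 < radius" using cond_number_ge_1 u_neq_0 by simp
  have "norm u * 1 \<le> norm u * cond_number sm u G"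
    by (intro mult_left_mono cond_number_ge_1) simp
  then show "radius \<le> norm u" using cond_number_ge_1 by (simp add: field_simps)
qed

lemma norm_phi_le_radius: "norm (phi x) * radius \<le> norm x"
  using norm_phi_le[of x] cond_number_ge_1 by (simp add: field_simps)

lemma norm_u_add_le: "norm w \<le> radius \<Longrightarrow> norm (u + w) \<le> 2 * norm u"
  using norm_triangle_ineq[of u w] radius_bounds by linarith

text \<open>The three summands under \<open>S\<close> are at most 1, 2 tau and 1 times
  \<open>norm H * norm g\<close>. As tau is at least 1 they total at most 4 tau, and
  \<open>S\<close> contributes gamma, so the factor is 4/6. Two points \<open>w\<close> and
  \<open>w'\<close> are allowed so that the bound serves both derivatives (\<open>w' = w\<close>)
  and differences.\<close>

lemma deriv_contraction:
  assumes H: "in_range H" and w: "norm w \<le> radius" and w': "norm w' \<le> radius"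
  shows "norm (S (sm (phi (H g)) w + sm (phi (H (u + w'))) g - H g)) \<le> 2 / 3 * norm g"
proof -
  let ?\<tau> = "cond_number sm u G" and ?\<gamma> = "spec_isolation sm L lam u G" and ?h = "norm H"
  note \<tau> = cond_number_ge_1
  have "norm (phi (H g)) * norm w \<le> norm (phi (H g)) * radius"
    by (intro mult_left_mono w) simp
  also have "\<dots> \<le> norm (H g)" by (rule norm_phi_le_radius)
  also have Hg: "\<dots> \<le> ?h * norm g" by (rule norm_blinfun)
  finally have 1: "norm (phi (H g)) * norm w \<le> ?h * norm g" .
  have "norm (phi (H (u + w'))) * norm u \<le> ?\<tau> * norm (H (u + w'))" by (rule norm_phi_le)
  also have "\<dots> \<le> ?\<tau> * (?h * (2 * norm u))"
    by (intro mult_left_mono order_trans[OF norm_blinfun] norm_u_add_le w') (use \<tau> in auto)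
  finally have "norm (phi (H (u + w'))) \<le> 2 * ?\<tau> * ?h" using u_neq_0 by simp
  then have 2: "norm (phi (H (u + w'))) * norm g \<le> 2 * ?\<tau> * ?h * norm g"
    by (rule mult_right_mono) simp
  have 3: "?h * norm g \<le> ?\<tau> * (?h * norm g)"
    using mult_right_mono[OF \<tau>, of "?h * norm g"] by simp
  have "norm (sm (phi (H g)) w + sm (phi (H (u + w'))) g - H g)
      \<le> norm (phi (H g)) * norm w + norm (phi (H (u + w'))) * norm g + norm (H g)"
    using norm_triangle_ineq4 norm_triangle_ineq by (smt (verit) norm_sm)
  also have "\<dots> \<le> 4 * ?\<tau> * ?h * norm g" using 1 2 3 Hg by linarith
  finally have "norm (S (sm (phi (H g)) w + sm (phi (H (u + w'))) g - H g)) \<le> ?\<gamma> * (4 * ?\<tau> * ?h * norm g)"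
    by (intro order_trans[OF norm_S_le] mult_left_mono spec_isolation_nonneg)
  also have "\<dots> = 2 / 3 * norm g * (6 * ?\<tau> * ?\<gamma> * ?h)" by simp
  also have "\<dots> \<le> 2 / 3 * norm g * 1" using H by (intro mult_left_mono) auto
  finally show ?thesis by simp
qed

text \<open>\<open>pert_map\<close> is quadratic in \<open>w\<close>, so its difference at two
  points is exactly the expression of \<open>deriv_contraction\<close> with
  \<open>g = w - w'\<close>.\<close>

lemma pert_map_contraction:
  assumes "in_range H" "norm w \<le> radius" "norm w' \<le> radius"
  shows "norm (pert_map H w - pert_map H w') \<le> 2 / 3 * norm (w - w')"
proof -
  have "pert_map H w - pert_map H w'
      = S (sm (phi (H (w - w'))) w + sm (phi (H (u + w'))) (w - w') - H (w - w'))"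
    unfolding pert_map_def S.diff[symmetric]
    by (rule arg_cong[of _ _ S]) (simp add: blinfun.add_right blinfun.diff_right phi_add phi.diff
        sm_add_left sm.diff_left sm.diff_right)
  then show ?thesis using deriv_contraction[OF assms] by simp
qed

text \<open>Both terms under \<open>S\<close> are at most \<open>norm (H (u + w))\<close>, hence at
  most \<open>2 * norm H * norm u\<close>. The spare third of the radius is used when the base point
  moves.\<close>

lemma norm_pert_map_le:
  assumes H: "in_range H" and w: "norm w \<le> radius"
  shows "norm (pert_map H w) \<le> 2 / 3 * radius"
proof -
  let ?\<tau> = "cond_number sm u G" and ?\<gamma> = "spec_isolation sm L lam u G" and ?h = "norm H"
  have Hx: "norm (H (u + w)) \<le> ?h * (2 * norm u)"
    by (intro order_trans[OF norm_blinfun] mult_left_mono norm_u_add_le w) simp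
  have "norm (phi (H (u + w))) * norm w \<le> norm (phi (H (u + w))) * radius"
    by (intro mult_left_mono w) simp
  also have "\<dots> \<le> norm (H (u + w))" by (rule norm_phi_le_radius)
  finally have "norm (sm (phi (H (u + w))) w - H (u + w)) \<le> 4 * ?h * norm u"
    using Hx norm_triangle_ineq4[of "sm (phi (H (u + w))) w" "H (u + w)"] by simp
  then have "norm (pert_map H w) \<le> ?\<gamma> * (4 * ?h * norm u)"
    unfolding pert_map_def by (intro order_trans[OF norm_S_le] mult_left_mono spec_isolation_nonneg)
  also have "\<dots> = 2 / 3 * radius * (6 * ?\<tau> * ?\<gamma> * ?h)" using cond_number_ge_1 by (simp add: field_simps)
  also have "\<dots> \<le> 2 / 3 * radius * 1" using H radius_bounds by (intro mult_left_mono) auto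
  finally show ?thesis by simp
qed

lemma ex1_pert_map_fixed:
  assumes H: "in_range H"
  shows "\<exists>!w. w \<in> G \<inter> cball 0 radius \<and> pert_map H w = w"
proof (rule Banach_fix)
  show "complete (G \<inter> cball 0 radius)" using closed_G by (simp add: complete_eq_closed closed_Int)
  show "G \<inter> cball 0 radius \<noteq> {}" using radius_bounds by (auto intro!: exI[of _ 0])
  have "norm (pert_map H w) \<le> radius" if "norm w \<le> radius" for w
    using norm_pert_map_le[OF H that] radius_bounds(1) by linarith
  then show "pert_map H ` (G \<inter> cball 0 radius) \<subseteq> G \<inter> cball 0 radius"
    by (auto simp: pert_map_def)
  show "dist (pert_map H w) (pert_map H w') \<le> 2 / 3 * dist w w'"
    if "w \<in> G \<inter> cball 0 radius" "w' \<in> G \<inter> cball 0 radius" for w w'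
    using pert_map_contraction[OF H, of w w'] that by (simp add: dist_norm)
qed auto

end

section \<open>Power series of the eigenvalue\<close>

text \<open>Scaled Catalan numbers: the n-th value is Cat(n) D^n a^(n+1). The generating function
  satisfies f(t) = a + D t f(t)^2, whence the condition \<open>4 * D * a * r <= 1\<close>
  below.\<close>

fun majorant :: "real \<Rightarrow> real \<Rightarrow> nat \<Rightarrow> real" where
  "majorant D a 0 = a"
| "majorant D a (Suc n) = D * (\<Sum>i\<le>n. majorant D a i * majorant D a (n - i))"

lemma majorant_nonneg: "0 \<le> D \<Longrightarrow> 0 \<le> a \<Longrightarrow> 0 \<le> majorant D a n"
  by (induction D a n rule: majorant.induct) (auto intro!: mult_nonneg_nonneg sum_nonneg)

text \<open>Enlarging the triangle of index pairs to a square bounds the next partial sum by a + D r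
  s^2, where s is the current one; s <= 2a is preserved because 4 D a r <= 1.\<close>

lemma majorant_sum_le:
  assumes D: "0 \<le> D" and a: "0 \<le> a" and r: "0 \<le> r" "4 * D * a * r \<le> 1"
  shows "(\<Sum>n<N. majorant D a n * r ^ n) \<le> 2 * a"
proof (induction N)
  case (Suc N)
  define b where "b n = majorant D a n * r ^ n" for n
  have b: "0 \<le> b n" for n using majorant_nonneg[OF D a] r(1) by (simp add: b_def)
  have b_Suc: "b (Suc n) = D * r * (\<Sum>i\<le>n. b i * b (n - i))" for n
    by (simp add: b_def sum_distrib_left mult_ac flip: power_add)
       (rule sum.cong, auto simp: mult_ac simp flip: power_add)
  have "(\<Sum>n<N. \<Sum>i\<le>n. b i * b (n - i)) = (\<Sum>(i, j)\<in>{(i, j). i + j < N}. b i * b j)"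
    by (rule sum.triangle_reindex[symmetric])
  also have "\<dots> \<le> (\<Sum>(i, j)\<in>{..<N} \<times> {..<N}. b i * b j)"
    by (rule sum_mono2) (use b in auto)
  also have "\<dots> = (\<Sum>n<N. b n) * (\<Sum>n<N. b n)"
    by (simp add: sum_product sum.cartesian_product)
  also have "\<dots> \<le> (2 * a) * (2 * a)"
    using Suc a b by (intro mult_mono sum_nonneg) (auto simp: b_def)
  finally have "D * r * (\<Sum>n<N. \<Sum>i\<le>n. b i * b (n - i)) \<le> D * r * ((2 * a) * (2 * a))"
    using D r by (intro mult_left_mono) auto
  also have "\<dots> = a * (4 * D * a * r)" by simp
  also have "\<dots> \<le> a * 1" by (intro mult_left_mono r a)
  finally have "b 0 + (\<Sum>n<N. b (Suc n)) \<le> 2 * a"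
    by (simp add: b_Suc b_def[of 0] flip: sum_distrib_left)
  then show ?case by (simp only: sum.lessThan_Suc_shift b_def)
qed (use a in simp)

lemma summable_majorant:
  assumes "0 \<le> D" "0 \<le> a" "0 \<le> r" "4 * D * a * r \<le> 1"
  shows "summable (\<lambda>n. majorant D a n * r ^ n)"
    and "(\<Sum>n. majorant D a n * r ^ n) \<le> 2 * a"
proof -
  show s: "summable (\<lambda>n. majorant D a n * r ^ n)"
    by (rule bounded_imp_summable[of _ "2 * a"])
      (use majorant_nonneg assms majorant_sum_le[OF assms, of "Suc _"] in \<open>auto simp: lessThan_Suc_atMost\<close>)
  show "(\<Sum>n. majorant D a n * r ^ n) \<le> 2 * a"
    by (intro suminf_le_const s majorant_sum_le assms)
qed

section \<open>Symmetrised multilinear forms\<close>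

text \<open>\<open>bsml_form\<close> demands symmetry, which the recursively built coefficients
  lack. Averaging over permutations leaves the diagonal values, and thus the power series,
  unchanged.\<close>

definition symmetrize :: "nat \<Rightarrow> ((nat \<Rightarrow> 'b) \<Rightarrow> 'k::real_normed_field) \<Rightarrow> (nat \<Rightarrow> 'b) \<Rightarrow> 'k" where
  "symmetrize n f v = (\<Sum>p | p permutes {..<n}. f (v \<circ> p)) / of_nat (fact n)"

lemma symmetrize_const: "symmetrize n f (\<lambda>_. h) = f (\<lambda>_. h)"
  by (simp add: symmetrize_def card_permutations comp_def)

lemma symmetrize_permute:
  assumes "p permutes {..<n}"
  shows "symmetrize n f (v \<circ> p) = symmetrize n f v"
proof -
  have "(\<Sum>q | q permutes {..<n}. f (v \<circ> q)) = (\<Sum>q | q permutes {..<n}. f (v \<circ> (p \<circ> q)))"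
    by (rule setum_permutations_compose_left[OF assms])
  then show ?thesis by (simp add: symmetrize_def comp_assoc)
qed

context K_space
begin

text \<open>Linearity in a slot is expressed by a pointwise equation for \<open>z\<close>, since the
  operator type carries no multiplication by scalars of type \<open>'k\<close>. Averaging keeps the
  bound because the product of norms is invariant under permutations.\<close>

lemma
  assumes cong: "\<And>v w. (\<And>i. i < n \<Longrightarrow> v i = w i) \<Longrightarrow> f v = f w"
    and linear: "\<And>i v c x y z. i < n \<Longrightarrow> (\<And>j. j < n \<Longrightarrow> v j \<in> K_ops sm) \<Longrightarrow>
      x \<in> K_ops sm \<Longrightarrow> y \<in> K_ops sm \<Longrightarrow> z \<in> K_ops sm \<Longrightarrow> (\<And>t. blinfun_apply z t = sm c (x t) + y t) \<Longrightarrow>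
      f (v(i := z)) = c * f (v(i := x)) + f (v(i := y))"
    and bound: "\<And>v. norm (f v) \<le> C * (\<Prod>j<n. norm (v j))" and C: "0 \<le> C"
  shows bsml_form_symmetrize: "bsml_form sm n (symmetrize n f)"
    and ml_norm_symmetrize_nonneg: "0 \<le> ml_norm sm n (symmetrize n f)"
    and ml_norm_symmetrize_le: "ml_norm sm n (symmetrize n f) \<le> C"
proof -
  have lin: "symmetrize n f (v(i := z)) = c * symmetrize n f (v(i := x)) + symmetrize n f (v(i := y))"
    if i: "i < n" and v: "\<And>j. j < n \<Longrightarrow> v j \<in> K_ops sm" and xyz: "x \<in> K_ops sm" "y \<in> K_ops sm" "z \<in> K_ops sm"
      "\<And>t. blinfun_apply z t = sm c (x t) + y t" for i v c x y z
  proof -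
    have "f (v(i := z) \<circ> p) = c * f (v(i := x) \<circ> p) + f (v(i := y) \<circ> p)"
      if p: "p permutes {..<n}" for p
    proof -
      \<comment> \<open>Composing with \<open>p\<close> moves the updated slot from \<open>i\<close>
        to \<open>inv p i\<close>.\<close>
      have upd: "v(i := t) \<circ> p = (v \<circ> p)(inv p i := t)" for t
        using permutes_inverses[OF p] by (auto simp: fun_eq_iff)
      have "inv p i < n" using permutes_in_image[OF permutes_inv[OF p], of i] i by simp
      moreover have "(v \<circ> p) j \<in> K_ops sm" if "j < n" for j
        using v permutes_in_image[OF p, of j] that by simp
      ultimately show ?thesis unfolding upd using xyz by (intro linear) auto
    qed
    then show ?thesis
      by (simp add: symmetrize_def sum.distrib add_divide_distrib flip: sum_distrib_left)
  qed
  have bd: "norm (symmetrize n f v) \<le> C * (\<Prod>j<n. norm (v j))" for v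
  proof -
    have "norm (\<Sum>p | p permutes {..<n}. f (v \<circ> p))
        \<le> (\<Sum>p | p permutes {..<n}. C * (\<Prod>j<n. norm (v j)))"
    proof (rule sum_norm_le)
      fix p assume p: "p \<in> {p. p permutes {..<n}}"
      have "(\<Prod>j<n. norm (v (p j))) = (\<Prod>j<n. norm (v j))"
        using prod.permute[of p "{..<n}" "\<lambda>j. norm (v j)"] p by (simp add: comp_def)
      then show "norm (f (v \<circ> p)) \<le> C * (\<Prod>j<n. norm (v j))" using bound[of "v \<circ> p"] by simp
    qed
    also have "\<dots> = fact n * (C * (\<Prod>j<n. norm (v j)))" by (simp add: card_permutations)
    finally show ?thesis by (simp add: symmetrize_def norm_divide field_simps)
  qed
  have cg: "symmetrize n f v = symmetrize n f w" if "\<And>i. i < n \<Longrightarrow> v i = w i" for v w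
    unfolding symmetrize_def
    by (rule arg_cong[of _ _ "\<lambda>t. t / _"], rule sum.cong[OF refl], rule cong)
      (use that permutes_in_image in fastforce)
  show "bsml_form sm n (symmetrize n f)"
    unfolding bsml_form_def
  proof (intro conjI allI impI ballI)
    fix i v x y assume iv: "i < n" "\<forall>j<n. v j \<in> K_ops sm" "x \<in> K_ops sm" "y \<in> K_ops sm"
    show "symmetrize n f (v(i := x + y)) = symmetrize n f (v(i := x)) + symmetrize n f (v(i := y))"
      using lin[of i v x y "x + y" 1] iv by (auto simp: blinfun.add_left)
    \<comment> \<open>Additivity with all three operators zero gives this; the summand for
      \<open>0\<close> then drops out of \<open>lin\<close> and homogeneity remains.\<close>
    have "symmetrize n f (v(i := 0)) = 0"
      using lin[of i v 0 0 0 0] lin[of i v 0 0 0 1] iv by auto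
    then show "symmetrize n f (v(i := y)) = c * symmetrize n f (v(i := x))"
      if "\<forall>z. blinfun_apply y z = sm c (blinfun_apply x z)" for c
      using lin[of i v x 0 y c] iv that by auto
  next
    show "symmetrize n f v = symmetrize n f w" if "\<forall>i<n. v i = w i" for v w
      using that by (intro cg) simp
    show "symmetrize n f (v \<circ> p) = symmetrize n f v" if "p permutes {..<n}" for p v
      by (rule symmetrize_permute[OF that])
    show "\<exists>C. \<forall>v. (\<forall>j<n. v j \<in> K_ops sm) \<longrightarrow> norm (symmetrize n f v) \<le> C * (\<Prod>j<n. norm (v j))"
      using bd by blast
  qed
  let ?A = "{norm (symmetrize n f v) |v. \<forall>j<n. v j \<in> K_ops sm \<and> norm (v j) \<le> 1}"
  have le: "a \<le> C" if a: "a \<in> ?A" for a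
  proof -
    obtain v where v: "a = norm (symmetrize n f v)" "\<forall>j<n. norm (v j) \<le> 1" using a by auto
    have "C * (\<Prod>j<n. norm (v j)) \<le> C * 1"
      using v C by (intro mult_left_mono prod_le_1) auto
    then show ?thesis using bd[of v] v by simp
  qed
  have A: "norm (symmetrize n f (\<lambda>_. 0)) \<in> ?A" by (auto intro!: exI[of _ "\<lambda>_. 0"])
  then show "ml_norm sm n (symmetrize n f) \<le> C"
    unfolding ml_norm_def using le by (intro cSup_least) auto
  have "norm (symmetrize n f (\<lambda>_. 0)) \<le> ml_norm sm n (symmetrize n f)"
    unfolding ml_norm_def using le by (intro cSup_upper A) (auto simp: bdd_above_def)
  then show "0 \<le> ml_norm sm n (symmetrize n f)" using norm_ge_zero order_trans by blast
qed

end

section \<open>Coefficients of the perturbed eigenvector and eigenvalue\<close>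

context sie
begin

text \<open>Multilinear versions of the homogeneous terms of the solution of
  \<open>w = pert_map H w\<close>: the term of degree \<open>n\<close> of \<open>u + w\<close> is \<open>pert_coeff n (\<lambda>_. H)\<close>.\<close>

fun pert_coeff :: "nat \<Rightarrow> (nat \<Rightarrow> 'a \<Rightarrow>\<^sub>L 'a) \<Rightarrow> 'a" where
  "pert_coeff 0 v = u"
| "pert_coeff (Suc n) v = S ((\<Sum>i<n. sm (phi (v n (pert_coeff i v))) (pert_coeff (n - i) (\<lambda>k. v (i + k))))
      - v n (pert_coeff n v))"

lemma pert_coeff_cong: "(\<And>i. i < n \<Longrightarrow> v i = w i) \<Longrightarrow> pert_coeff n v = pert_coeff n w"
proof (induction n v arbitrary: w rule: pert_coeff.induct)
  case (2 n v)
  have "pert_coeff i v = pert_coeff i w" "pert_coeff (n - i) (\<lambda>k. v (i + k)) = pert_coeff (n - i) (\<lambda>k. w (i + k))"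
    if "i < n" for i
    using 2 that by (auto intro!: 2)
  moreover have "pert_coeff n v = pert_coeff n w" "v n = w n" using 2 by auto
  ultimately show ?case by simp
qed simp

text \<open>Each slot enters every summand exactly once: the last slot is the outermost operator,
  the slots below the summation index feed the first factor and the others the shifted second
  factor. Strong induction applies to whichever factor contains slot \<open>i\<close>.\<close>

lemma pert_coeff_linear:
  assumes "i < n" "\<And>j. j < n \<Longrightarrow> v j \<in> K_ops sm" "x \<in> K_ops sm" "y \<in> K_ops sm" "z \<in> K_ops sm"
    and "\<And>t. blinfun_apply z t = sm c (x t) + y t"
  shows "pert_coeff n (v(i := z)) = sm c (pert_coeff n (v(i := x))) + pert_coeff n (v(i := y))"
  using assms(1,2)
proof (induction n arbitrary: i v rule: less_induct)
  case (less m)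
  then obtain n where m: "m = Suc n" by (cases m) auto
  have shift: "(\<lambda>k. (v(i := t)) (j + k)) = (\<lambda>k. v (j + k))(i - j := t)" if "j \<le> i" for j t
    using that by (auto simp: fun_eq_iff)
  show ?case
  proof (cases "i = n")
    case True
    have 1: "pert_coeff j (v(n := t)) = pert_coeff j v" if "j \<le> n" for j t
      using that by (intro pert_coeff_cong) auto
    have 2: "pert_coeff (n - j) (\<lambda>k. (v(n := t)) (j + k)) = pert_coeff (n - j) (\<lambda>k. v (j + k))" if "j < n" for j t
      using that by (intro pert_coeff_cong) auto
    have eq: "pert_coeff m (v(n := t))
        = S ((\<Sum>j<n. sm (phi (t (pert_coeff j v))) (pert_coeff (n - j) (\<lambda>k. v (j + k)))) - t (pert_coeff n v))" for t
      unfolding m pert_coeff.simps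
      by (intro arg_cong[of _ _ S] arg_cong2[of _ _ _ _ minus] sum.cong refl)
        (simp_all add: 1 2 fun_upd_same del: fun_upd_apply)
    show ?thesis
      unfolding True eq S_sm[symmetric] S_add[symmetric]
      by (rule arg_cong[of _ _ S])
        (simp add: assms(6) phi_add phi_sm sm_add_left sum.distrib sm.sum_right sm.diff_right)
  next
    case False
    then have i: "i < n" using less.prems m by simp
    have vn: "v n \<in> K_ops sm" using less.prems m by simp
    have n: "pert_coeff n (v(i := z)) = sm c (pert_coeff n (v(i := x))) + pert_coeff n (v(i := y))"
      using i m less.prems by (intro less.IH) auto
    let ?t = "\<lambda>t j. sm (phi (v n (pert_coeff j (v(i := t))))) (pert_coeff (n - j) (\<lambda>k. (v(i := t)) (j + k)))"
    have t: "?t z j = sm c (?t x j) + ?t y j" if j: "j < n" for j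
    proof (cases "i < j")
      case True
      have "pert_coeff j (v(i := z)) = sm c (pert_coeff j (v(i := x))) + pert_coeff j (v(i := y))"
        using True j m less.prems by (intro less.IH) auto
      moreover have "pert_coeff (n - j) (\<lambda>k. (v(i := t)) (j + k)) = pert_coeff (n - j) (\<lambda>k. v (j + k))" for t
        using True by (intro pert_coeff_cong) auto
      ultimately show ?thesis
        by (simp add: blinfun.add_right K_ops_apply[OF vn] phi_add phi_sm sm_add_left)
    next
      case False
      then have ji: "j \<le> i" by simp
      have "pert_coeff j (v(i := t)) = pert_coeff j v" for t
        using False by (intro pert_coeff_cong) auto
      moreover have "pert_coeff (n - j) ((\<lambda>k. v (j + k))(i - j := z))
        = sm c (pert_coeff (n - j) ((\<lambda>k. v (j + k))(i - j := x))) + pert_coeff (n - j) ((\<lambda>k. v (j + k))(i - j := y))"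
        using less.prems m i ji by (intro less.IH) auto
      ultimately show ?thesis
        by (simp only: shift[OF ji] sm_add_right sm_assoc mult.commute)
    qed
    have sum: "(\<Sum>j<n. ?t z j) = sm c (\<Sum>j<n. ?t x j) + (\<Sum>j<n. ?t y j)"
      by (simp add: t sum.distrib sm.sum_right del: fun_upd_apply)
    have eq: "pert_coeff m (v(i := t)) = S ((\<Sum>j<n. ?t t j) - v n (pert_coeff n (v(i := t))))" for t
      unfolding m pert_coeff.simps using False by simp
    show ?thesis
      unfolding eq sum n S_sm[symmetric] S_add[symmetric]
      by (rule arg_cong[of _ _ S])
        (simp add: sm.diff_right blinfun.add_right K_ops_apply[OF vn])
  qed
qed

text \<open>The convolution terms account for \<open>K\<close>. The remaining term
  \<open>v n (pert_coeff n v)\<close> is treated as the missing index \<open>i = n\<close> of the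
  convolution, whose weight \<open>a n * a 0\<close> contains \<open>a 0 = norm u\<close>; this
  explains \<open>1 / norm u\<close>.\<close>

lemma norm_pert_coeff_le:
  assumes K: "0 \<le> K" "\<And>x. norm (phi x) \<le> K * norm x"
    and C: "0 \<le> C" "\<And>x. norm (S x) \<le> C * norm x"
  shows "norm (pert_coeff n v) \<le> majorant (C * (K + 1 / norm u)) (norm u) n * (\<Prod>j<n. norm (v j))"
proof (induction n v rule: pert_coeff.induct)
  case (2 n v)
  define a where "a = majorant (C * (K + 1 / norm u)) (norm u)"
  define P where "P = (\<Prod>j<n. norm (v j))"
  have a: "0 \<le> a i" for i unfolding a_def by (rule majorant_nonneg) (use K C in auto)
  have term_le: "norm (sm (phi (v n (pert_coeff i v))) (pert_coeff (n - i) (\<lambda>k. v (i + k))))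
      \<le> K * norm (v n) * P * (a i * a (n - i))" if i: "i < n" for i
  proof -
    have "norm (phi (v n (pert_coeff i v))) \<le> K * (norm (v n) * norm (pert_coeff i v))"
      by (intro order_trans[OF K(2)] mult_left_mono norm_blinfun K)
    also have "\<dots> \<le> K * (norm (v n) * (a i * (\<Prod>j<i. norm (v j))))"
      using 2(1) i by (intro mult_left_mono K) (auto simp: a_def)
    finally have "norm (sm (phi (v n (pert_coeff i v))) (pert_coeff (n - i) (\<lambda>k. v (i + k))))
      \<le> K * (norm (v n) * (a i * (\<Prod>j<i. norm (v j)))) * (a (n - i) * (\<Prod>j<n - i. norm (v (i + j))))"
      using 2(2) i a K by (simp only: norm_sm) (intro mult_mono, auto simp: a_def intro!: mult_nonneg_nonneg prod_nonneg)
    also have "\<dots> = K * norm (v n) * ((\<Prod>j<i. norm (v j)) * (\<Prod>j<n - i. norm (v (i + j)))) * (a i * a (n - i))"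
      by simp
    also have "(\<Prod>j<i. norm (v j)) * (\<Prod>j<n - i. norm (v (i + j))) = P"
      using prod.atLeastLessThan_concat[of 0 i n "\<lambda>j. norm (v j)"] i
        prod.atLeastLessThan_shift_0[of "\<lambda>j. norm (v j)" i n]
      by (simp add: P_def lessThan_atLeast0 comp_def)
    finally show ?thesis .
  qed
  have "norm (v n (pert_coeff n v)) \<le> norm (v n) * (a n * P)"
    by (intro order_trans[OF norm_blinfun] mult_left_mono) (use 2(3) in \<open>auto simp: a_def P_def\<close>)
  then have "norm ((\<Sum>i<n. sm (phi (v n (pert_coeff i v))) (pert_coeff (n - i) (\<lambda>k. v (i + k)))) - v n (pert_coeff n v))
     \<le> (\<Sum>i<n. K * norm (v n) * P * (a i * a (n - i))) + norm (v n) * (a n * P)"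
    using term_le by (intro order_trans[OF norm_triangle_ineq4] add_mono sum_norm_le) auto
  also have "\<dots> = (K * (\<Sum>i<n. a i * a (n - i)) + (1 / norm u) * (a n * a 0)) * (norm (v n) * P)"
    using u_neq_0 by (simp add: sum_distrib_left sum_distrib_right algebra_simps a_def)
  also have "\<dots> \<le> ((K + 1 / norm u) * (\<Sum>i\<le>n. a i * a (n - i))) * (norm (v n) * P)"
  proof (intro mult_right_mono)
    have "K * (\<Sum>i<n. a i * a (n - i)) + 1 / norm u * (a n * a 0)
        \<le> (K + 1 / norm u) * (\<Sum>i<n. a i * a (n - i)) + (K + 1 / norm u) * (a n * a 0)"
      using a K by (intro add_mono mult_right_mono sum_nonneg) auto
    then show "K * (\<Sum>i<n. a i * a (n - i)) + 1 / norm u * (a n * a 0)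
        \<le> (K + 1 / norm u) * (\<Sum>i\<le>n. a i * a (n - i))"
      by (simp add: lessThan_Suc_atMost[symmetric] distrib_left)
  qed (auto simp: P_def intro!: mult_nonneg_nonneg prod_nonneg)
  finally have "norm (pert_coeff (Suc n) v)
      \<le> C * (((K + 1 / norm u) * (\<Sum>i\<le>n. a i * a (n - i))) * (norm (v n) * P))"
    unfolding pert_coeff.simps by (intro order_trans[OF C(2)] mult_left_mono C)
  then show ?case by (simp add: a_def P_def mult_ac)
qed simp

text \<open>The eigenvalue is \<open>lam + phi (H x)\<close>; the operator in front of the
  eigenvector raises the degree by one.\<close>

definition eig_coeff :: "nat \<Rightarrow> (nat \<Rightarrow> 'a \<Rightarrow>\<^sub>L 'a) \<Rightarrow> 'k" where
  "eig_coeff n v = (case n of 0 \<Rightarrow> lam | Suc m \<Rightarrow> phi (v m (pert_coeff m v)))"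

lemma eig_coeff_cong: "(\<And>i. i < n \<Longrightarrow> v i = w i) \<Longrightarrow> eig_coeff n v = eig_coeff n w"
  using pert_coeff_cong[of "n - 1" v w] by (auto simp: eig_coeff_def split: nat.split)

lemma eig_coeff_linear:
  assumes "i < n" "\<And>j. j < n \<Longrightarrow> v j \<in> K_ops sm" "x \<in> K_ops sm" "y \<in> K_ops sm" "z \<in> K_ops sm"
    and "\<And>t. blinfun_apply z t = sm c (x t) + y t"
  shows "eig_coeff n (v(i := z)) = c * eig_coeff n (v(i := x)) + eig_coeff n (v(i := y))"
proof -
  obtain m where m: "n = Suc m" using assms(1) by (cases n) auto
  show ?thesis
  proof (cases "i = m")
    case True
    have "pert_coeff m (v(m := t)) = pert_coeff m v" for t by (rule pert_coeff_cong) auto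
    then show ?thesis by (simp add: eig_coeff_def m True assms(6) phi_add phi_sm)
  next
    case False
    then have "pert_coeff m (v(i := z)) = sm c (pert_coeff m (v(i := x))) + pert_coeff m (v(i := y))"
      using assms m by (intro pert_coeff_linear) auto
    moreover have "v m \<in> K_ops sm" using assms m by simp
    ultimately show ?thesis
      using False by (simp add: eig_coeff_def m phi_add phi_sm blinfun.add_right K_ops_apply)
  qed
qed

text \<open>The conclusion mentions only an eigenpair, not the fixed point, so that it can be used
  at another base point and compared with the fixed point there. Here \<epsilon> keeps the
  eigenvector close enough for this comparison and \<delta> keeps the perturbation inside the
  ball.\<close>

lemma eigenvalue_power_series:
  assumes \<epsilon>: "\<epsilon> > 0" and \<delta>: "\<delta> > 0"
  shows "\<exists>r>0. r \<le> \<delta> \<and> (\<exists>Ps. (\<forall>n. bsml_form sm n (Ps n)) \<and> summable (\<lambda>n. ml_norm sm n (Ps n) * r ^ n) \<and>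
    (\<forall>H\<in>K_ops sm. norm H < r \<longrightarrow>
      (\<exists>\<mu> x. (\<lambda>n. Ps n (\<lambda>_. H)) sums \<mu> \<and> (L + H) x = sm \<mu> x \<and> norm (x - u) < \<epsilon>)))"
proof -
  obtain C where C: "C > 0" "\<And>z. norm (S z) \<le> norm z * C" using S.pos_bounded by blast
  obtain K where K: "K > 0" "\<And>z. norm (phi z) \<le> norm z * K" using phi.pos_bounded by blast
  define D where "D = C * (K + 1 / norm u)"
  have D: "D > 0" using C K u_neq_0 by (auto simp: D_def add_pos_nonneg)
  define a where "a = majorant D (norm u)"
  have a: "0 \<le> a n" for n unfolding a_def by (rule majorant_nonneg) (use D in auto)
  have coeff_le: "norm (pert_coeff n v) \<le> a n * (\<Prod>j<n. norm (v j))" for n v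
    unfolding a_def D_def by (rule norm_pert_coeff_le) (use C K in \<open>auto simp: mult.commute\<close>)
  define R where "R = 1 / (4 * D * norm u)"
  have R: "R > 0" "4 * D * norm u * R \<le> 1" using D u_neq_0 by (simp_all add: R_def)
  have sum_R: "summable (\<lambda>n. a n * R ^ n)" and sum_R_le: "(\<Sum>n. a n * R ^ n) \<le> 2 * norm u"
    unfolding a_def using summable_majorant[of D "norm u" R] R D by auto
  \<comment> \<open>The last bound serves the estimate
    \<open>norm w <= norm H / R * (2 * norm u)\<close>, making \<open>norm w\<close> smaller than
    \<epsilon>.\<close>
  define r where "r = min \<delta> (min R (\<epsilon> * R / (2 * norm u)))"
  have r: "r > 0" "r \<le> R" "r \<le> \<delta>" using R \<epsilon> \<delta> u_neq_0 by (auto simp: r_def)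
  define Cn where "Cn n = (case n of 0 \<Rightarrow> norm lam | Suc m \<Rightarrow> K * a m)" for n
  have Cn: "0 \<le> Cn n" for n using K a by (auto simp: Cn_def split: nat.split)
  have eig_le: "norm (eig_coeff n v) \<le> Cn n * (\<Prod>j<n. norm (v j))" for n v
  proof (cases n)
    case (Suc m)
    have "norm (phi (v m (pert_coeff m v))) \<le> (norm (v m) * (a m * (\<Prod>j<m. norm (v j)))) * K"
      using K by (intro order_trans[OF K(2)] mult_right_mono order_trans[OF norm_blinfun] mult_left_mono coeff_le) auto
    then show ?thesis by (simp add: Suc eig_coeff_def Cn_def mult_ac)
  qed (simp add: eig_coeff_def Cn_def)
  note sym = eig_coeff_cong eig_coeff_linear eig_le Cn
  let ?Ps = "\<lambda>n. symmetrize n (eig_coeff n)"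
  have bsml: "bsml_form sm n (?Ps n)" for n by (rule bsml_form_symmetrize[OF sym])
  have ml: "0 \<le> ml_norm sm n (?Ps n)" "ml_norm sm n (?Ps n) \<le> Cn n" for n
    by (rule ml_norm_symmetrize_nonneg[OF sym] ml_norm_symmetrize_le[OF sym]; assumption)+
  have sum_le: "summable (\<lambda>n. a n * t ^ n)" if "0 \<le> t" "t \<le> R" for t
    by (rule summable_comparison_test'[OF sum_R, of 0]) (use a that in \<open>auto intro!: mult_left_mono power_mono\<close>)
  have "summable (\<lambda>n. K * r * (a n * r ^ n))"
    using r by (intro summable_mult sum_le) auto
  then have "summable (\<lambda>n. Cn (Suc n) * r ^ Suc n)" by (simp add: Cn_def mult_ac)
  then have "summable (\<lambda>n. Cn n * r ^ n)" by (simp only: summable_Suc_iff[of "\<lambda>n. Cn n * r ^ n"])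
  then have sum: "summable (\<lambda>n. ml_norm sm n (?Ps n) * r ^ n)"
    by (rule summable_comparison_test'[of _ 0]) (use ml r in \<open>auto intro!: mult_right_mono\<close>)
  have "\<exists>\<mu> x. (\<lambda>n. ?Ps n (\<lambda>_. H)) sums \<mu> \<and> (L + H) x = sm \<mu> x \<and> norm (x - u) < \<epsilon>"
    if H: "H \<in> K_ops sm" "norm H < r" for H
  proof -
    define b where "b n = pert_coeff n (\<lambda>_. H)" for n
    have b_Suc: "b (Suc n) = S ((\<Sum>i<n. sm (phi (H (b i))) (b (n - i))) - H (b n))" for n
      by (simp add: b_def)
    have b_le: "norm (b n) \<le> a n * norm H ^ n" for n
      using coeff_le[of n "\<lambda>_. H"] by (simp add: b_def)
    have sum_b: "summable (\<lambda>n. norm (b n))"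
      by (rule summable_comparison_test'[OF sum_le[of "norm H"], of 0]) (use b_le H r in auto)
    define w where "w = (\<Sum>n. b (Suc n))"
    define x where "x = u + w"
    have sw: "(\<lambda>n. b (Suc n)) sums w"
      unfolding w_def using summable_norm_cancel[OF sum_b] by (intro summable_sums) (simp add: summable_Suc_iff)
    have "b 0 = u" by (simp add: b_def)
    then have sx: "b sums x"
      using sums_Suc[OF sw] by (simp add: x_def add.commute)
    \<comment> \<open>The series of \<open>w\<close> is that of \<open>x\<close> without its
      degree-0 term \<open>u\<close>. This is why the convolution in \<open>b_Suc\<close> omits
      \<open>i = n\<close>.\<close>
    define y where "y n = (if n = 0 then 0 else b n)" for n
    have "y (Suc n) = b (Suc n)" for n by (simp add: y_def)
    then have sy: "y sums w"
      using sums_Suc[of y w] sw by (simp add: y_def)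
    have sphi: "(\<lambda>n. phi (H (b n))) sums phi (H x)"
      by (intro phi.sums bounded_linear.sums[OF blinfun.bounded_linear_right] sx)
    have "norm (phi (H (b n))) \<le> norm (b n) * (norm H * K)" for n
      using order_trans[OF K(2) mult_right_mono[OF norm_blinfun[of H "b n"], of K]] K
      by (simp add: mult_ac)
    then have "summable (\<lambda>n. norm (phi (H (b n))))"
      by (intro summable_comparison_test'[OF summable_mult2[OF sum_b, of "norm H * K"], of 0]) auto
    moreover have "summable (\<lambda>n. norm (y n))"
      by (rule summable_comparison_test'[OF sum_b, of 0]) (auto simp: y_def)
    ultimately have "(\<lambda>n. \<Sum>i\<le>n. sm (phi (H (b i))) (y (n - i))) sums sm (phi (H x)) w"
      by (intro sm.Cauchy_product_sums sphi sy)
    moreover have "(\<Sum>i\<le>n. sm (phi (H (b i))) (y (n - i))) = (\<Sum>i<n. sm (phi (H (b i))) (b (n - i)))" for n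
      by (simp add: lessThan_Suc_atMost[symmetric] y_def)
    ultimately have "(\<lambda>n. \<Sum>i<n. sm (phi (H (b i))) (b (n - i))) sums sm (phi (H x)) w" by simp
    \<comment> \<open>Summing the recursion term by term turns it into the fixed-point equation for
      \<open>w\<close>.\<close>
    then have "(\<lambda>n. b (Suc n)) sums S (sm (phi (H x)) w - H x)"
      unfolding b_Suc by (intro S.sums sums_diff bounded_linear.sums[OF blinfun.bounded_linear_right] sx)
    from sums_unique2[OF this sw] have fixed: "pert_map H w = w"
      unfolding pert_map_def x_def .
    have wG: "w \<in> G" by (subst fixed[symmetric]) (simp only: pert_map_def S_in_G)
    have eig: "(L + H) x = sm (lam + phi (H x)) x"
      using pert_map_fixed_iff[OF wG, of H] fixed by (simp add: x_def)
    have "(\<lambda>n. ?Ps (Suc n) (\<lambda>_. H)) sums phi (H x)"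
      using sphi by (simp add: symmetrize_const eig_coeff_def b_def)
    then have "(\<lambda>n. ?Ps n (\<lambda>_. H)) sums (phi (H x) + ?Ps 0 (\<lambda>_. H))" by (rule sums_Suc)
    then have ser: "(\<lambda>n. ?Ps n (\<lambda>_. H)) sums (lam + phi (H x))"
      by (simp add: symmetrize_const eig_coeff_def add.commute)
    \<comment> \<open>One factor \<open>norm H\<close> is kept and the others are enlarged to
      \<open>R\<close>, so that the tail is linear in \<open>norm H\<close>.\<close>
    have "norm (b (Suc n)) \<le> norm H / R * (a (Suc n) * R ^ Suc n)" for n
    proof -
      have "norm H ^ Suc n \<le> norm H * R ^ n"
        using H r by (auto intro!: mult_left_mono power_mono)
      then have "norm (b (Suc n)) \<le> a (Suc n) * (norm H * R ^ n)"
        using a by (intro order_trans[OF b_le] mult_left_mono)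
      then show ?thesis using R by (simp add: mult.left_commute)
    qed
    moreover have sR: "summable (\<lambda>n. a (Suc n) * R ^ Suc n)"
      using sum_R by (simp only: summable_Suc_iff[of "\<lambda>n. a n * R ^ n"])
    ultimately have "norm w \<le> (\<Sum>n. norm H / R * (a (Suc n) * R ^ Suc n))"
      unfolding w_def by (intro norm_suminf_le summable_mult)
    also have "\<dots> = norm H / R * (\<Sum>n. a (Suc n) * R ^ Suc n)" by (rule suminf_mult[OF sR])
    also have "(\<Sum>n. a (Suc n) * R ^ Suc n) = (\<Sum>n. a n * R ^ n) - a 0"
      using suminf_split_head[OF sum_R] by simp
    also have "norm H / R * ((\<Sum>n. a n * R ^ n) - a 0) \<le> norm H / R * (2 * norm u)"
      using sum_R_le a[of 0] R by (intro mult_left_mono) auto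
    also have "\<dots> < \<epsilon>"
    proof -
      have "norm H < \<epsilon> * R / (2 * norm u)" using H(2) by (simp add: r_def)
      then show ?thesis using R u_neq_0 by (simp add: field_simps)
    qed
    finally have "norm (x - u) < \<epsilon>" by (simp add: x_def)
    with eig ser show ?thesis by blast
  qed
  with bsml sum r(1,3) show ?thesis by (intro exI[of _ r] conjI exI[of _ ?Ps]) auto
qed

end

section \<open>Analyticity on the ball\<close>

context sie
begin

definition pert_fix :: "('a \<Rightarrow>\<^sub>L 'a) \<Rightarrow> 'a" where
  "pert_fix H = (THE w. w \<in> G \<inter> cball 0 radius \<and> pert_map H w = w)"

definition pert_eigenvalue :: "('a \<Rightarrow>\<^sub>L 'a) \<Rightarrow> 'k" where
  "pert_eigenvalue H = lam + phi (H (u + pert_fix H))"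

lemma pert_fix:
  assumes "in_range H"
  shows "pert_fix H \<in> G" "norm (pert_fix H) \<le> radius" "pert_map H (pert_fix H) = pert_fix H"
  using theI'[OF ex1_pert_map_fixed[OF assms]] by (auto simp: pert_fix_def)

lemma pert_eigenvalue_zero: "pert_eigenvalue 0 = lam"
  by (simp add: pert_eigenvalue_def blinfun.zero_left)

lemma ex_sie_data_pert:
  assumes H: "H \<in> K_ops sm" "in_range H"
  shows "\<exists>G'. sie_data sm (L + H) (pert_eigenvalue H) (u + pert_fix H) G'"
  unfolding pert_eigenvalue_def
  by (rule simple_isolated_eigenvalue_perturb[of _ _ "2 / 3"])
    (use H pert_fix[OF H(2)] deriv_contraction[OF H(2)] in auto)

text \<open>An eigenvector is determined only up to a scalar; it is compared with \<open>u + pert_fix H\<close> after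
  rescaling it to satisfy \<open>phi x = 1\<close>.\<close>

lemma pert_eigenvalue_eqI:
  assumes H: "H \<in> K_ops sm" "in_range H" and eig: "(L + H) x = sm \<mu> x" and "phi x \<noteq> 0"
    and near: "norm (sm (inverse (phi x)) x - u) \<le> radius"
  shows "\<mu> = pert_eigenvalue H"
proof -
  define w where "w = sm (inverse (phi x)) x - u"
  have wG: "w \<in> G" using \<open>phi x \<noteq> 0\<close> by (simp add: w_def phi.diff phi_sm flip: phi_eq_0_iff)
  have "L + H \<in> K_ops sm" using L_K_ops H by blast
  then have eig_w: "(L + H) (u + w) = sm \<mu> (u + w)"
    using eig by (simp add: w_def K_ops_apply mult.commute)
  have \<mu>: "\<mu> = lam + phi (H (u + w))" by (rule eigenvalue_eq[OF wG eig_w])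
  then have "pert_map H w = w" using pert_map_fixed_iff[OF wG, of H] eig_w by simp
  then have "w = pert_fix H"
    using ex1_pert_map_fixed[OF H(2)] pert_fix[OF H(2)] wG near by (auto simp: w_def)
  then show ?thesis using \<mu> by (simp add: pert_eigenvalue_def)
qed

text \<open>At \<open>A = L + H0\<close> the power series is taken with respect to the eigenvector
  \<open>u + w\<close> of \<open>A\<close>. Its eigenvectors stay near \<open>u + w\<close>, and
  after rescaling they lie in the ball of radius \<open>radius\<close> about \<open>u\<close>, so
  \<open>pert_eigenvalue_eqI\<close> identifies the sum of the series.\<close>

lemma analytic_pert_eigenvalue:
  "K_analytic_on sm {A \<in> K_ops sm. in_range (A - L)} (\<lambda>A. pert_eigenvalue (A - L))"
  unfolding K_analytic_on_def
proof
  fix A assume A: "A \<in> {A \<in> K_ops sm. in_range (A - L)}"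
  define H0 where "H0 = A - L"
  have H0: "H0 \<in> K_ops sm" "in_range H0" using A L_K_ops by (auto simp: H0_def)
  define w where "w = pert_fix H0"
  note w = pert_fix[OF H0(2), folded w_def]
  obtain G' where "sie_data sm A (pert_eigenvalue H0) (u + w) G'"
    using ex_sie_data_pert[OF H0] by (auto simp: H0_def w_def)
  then interpret A: sie sm A "pert_eigenvalue H0" "u + w" G'
    using A by unfold_locales auto
  have w_small: "norm w \<le> 2 / 3 * radius"
    using norm_pert_map_le[OF H0(2) w(2)] w(3) by simp
  have phi_x: "phi (u + w) = 1" using w(1) by (simp add: phi_add phi_eq_0_iff)
  \<comment> \<open>A third of the radius is what remains beyond the bound
    \<open>2 / 3 * radius\<close> on \<open>w\<close>.\<close>
  have "\<forall>\<^sub>F x in nhds (u + w). phi x \<noteq> 0 \<and> dist (sm (inverse (phi x)) x) (u + w) < radius / 3"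
  proof (rule eventually_conj)
    have t: "(phi \<longlongrightarrow> phi (u + w)) (nhds (u + w))" by (intro phi.tendsto filterlim_ident)
    then show "\<forall>\<^sub>F x in nhds (u + w). phi x \<noteq> 0"
      by (rule tendsto_imp_eventually_ne) (simp add: phi_x)
    have "((\<lambda>x. sm (inverse (phi x)) x) \<longlongrightarrow> sm (inverse (phi (u + w))) (u + w)) (nhds (u + w))"
      by (intro sm.tendsto tendsto_inverse t filterlim_ident) (simp add: phi_x)
    then show "\<forall>\<^sub>F x in nhds (u + w). dist (sm (inverse (phi x)) x) (u + w) < radius / 3"
      using radius_bounds by (intro tendstoD) (simp_all add: phi_x)
  qed
  then obtain \<epsilon> where \<epsilon>: "\<epsilon> > 0" "\<And>x. dist x (u + w) < \<epsilon> \<Longrightarrow>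
      phi x \<noteq> 0 \<and> dist (sm (inverse (phi x)) x) (u + w) < radius / 3"
    unfolding eventually_nhds_metric by blast
  define \<kappa> where "\<kappa> = 6 * cond_number sm u G * spec_isolation sm L lam u G"
  have \<kappa>: "0 \<le> \<kappa>" "\<kappa> * norm H0 < 1"
    using cond_number_ge_1 spec_isolation_nonneg H0(2) by (auto simp: \<kappa>_def)
  \<comment> \<open>Chosen so that \<open>H0 + H\<close> stays in range for \<open>norm H\<close>
    below it; adding 1 to the denominator covers the case where \<kappa> is 0.\<close>
  define \<delta> where "\<delta> = (1 - \<kappa> * norm H0) / (\<kappa> + 1)"
  have "\<delta> > 0" using \<kappa> by (simp add: \<delta>_def)
  from A.eigenvalue_power_series[OF \<epsilon>(1) this] obtain r Ps where r: "r > 0" "r \<le> \<delta>"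
    and Ps: "\<forall>n. bsml_form sm n (Ps n)" "summable (\<lambda>n. ml_norm sm n (Ps n) * r ^ n)"
    and eig: "\<forall>H\<in>K_ops sm. norm H < r \<longrightarrow>
      (\<exists>\<mu> x. (\<lambda>n. Ps n (\<lambda>_. H)) sums \<mu> \<and> (A + H) x = sm \<mu> x \<and> norm (x - (u + w)) < \<epsilon>)"
    by (elim exE conjE) (rule that; assumption)
  have "A + H \<in> {A \<in> K_ops sm. in_range (A - L)} \<and> (\<lambda>n. Ps n (\<lambda>_. H)) sums pert_eigenvalue (A + H - L)"
    if H: "H \<in> K_ops sm" "norm H < r" for H
  proof -
    have AH: "A + H - L = H0 + H" "A + H = L + (H0 + H)" by (simp_all add: H0_def)
    have "(\<kappa> + 1) * norm H < 1 - \<kappa> * norm H0"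
    proof -
      have "norm H < \<delta>" using H(2) r(2) by simp
      then show ?thesis using \<kappa>(1) by (simp add: \<delta>_def pos_less_divide_eq mult.commute)
    qed
    then have "\<kappa> * norm H0 + \<kappa> * norm H < 1" using norm_ge_zero[of H] unfolding distrib_right by linarith
    moreover have "\<kappa> * norm (H0 + H) \<le> \<kappa> * (norm H0 + norm H)"
      by (intro mult_left_mono norm_triangle_ineq \<kappa>)
    ultimately have range: "in_range (H0 + H)" by (simp add: \<kappa>_def distrib_left)
    from eig[rule_format, OF H] obtain \<mu> x where \<mu>: "(\<lambda>n. Ps n (\<lambda>_. H)) sums \<mu>" "(A + H) x = sm \<mu> x"
      and x: "dist x (u + w) < \<epsilon>" by (auto simp: dist_norm)
    have "norm (sm (inverse (phi x)) x - u) \<le> norm (sm (inverse (phi x)) x - (u + w)) + norm w"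
      using norm_triangle_ineq[of "sm (inverse (phi x)) x - (u + w)" w] by simp
    also have "\<dots> \<le> radius" using \<epsilon>(2)[OF x] w_small by (simp add: dist_norm)
    finally have "\<mu> = pert_eigenvalue (H0 + H)"
      using \<epsilon>(2)[OF x] \<mu>(2) H H0 range by (intro pert_eigenvalue_eqI) (auto simp: AH)
    then show ?thesis
      using \<mu>(1) range H H0 L_K_ops by (auto simp: AH)
  qed
  then show "\<exists>r>0. \<exists>Ps. (\<forall>n. bsml_form sm n (Ps n)) \<and> summable (\<lambda>n. ml_norm sm n (Ps n) * r ^ n) \<and>
      (\<forall>H\<in>K_ops sm. norm H < r \<longrightarrow> A + H \<in> {A \<in> K_ops sm. in_range (A - L)} \<and>
        (\<lambda>n. Ps n (\<lambda>_. H)) sums pert_eigenvalue (A + H - L))"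
    using r(1) Ps by blast
qed

end

theorem theoremA:
  fixes sm :: "'k::{real_normed_field,banach} \<Rightarrow> 'a::banach \<Rightarrow> 'a"
    and L0 :: "'a \<Rightarrow>\<^sub>L 'a" and lam0 :: 'k and u0 :: 'a and G0 :: "'a set"
  assumes "K_structure sm"
    and "L0 \<in> K_ops sm"
    and "sie_data sm L0 lam0 u0 G0"
  shows "\<exists>lam :: ('a \<Rightarrow>\<^sub>L 'a) \<Rightarrow> 'k.
           lam L0 = lam0 \<and>
           K_analytic_on sm
             {L \<in> K_ops sm. 6 * cond_number sm u0 G0 * spec_isolation sm L0 lam0 u0 G0 * norm (L - L0) < 1}
             lam \<and>
           (\<forall>L \<in> {L \<in> K_ops sm. 6 * cond_number sm u0 G0 * spec_isolation sm L0 lam0 u0 G0 * norm (L - L0) < 1}.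
              simple_isolated_eigenvalue sm L (lam L))"
proof -
  interpret sie sm L0 lam0 u0 G0
    by unfold_locales (use assms in auto)
  have "simple_isolated_eigenvalue sm L (pert_eigenvalue (L - L0))"
    if "L \<in> K_ops sm" "in_range (L - L0)" for L
    using ex_sie_data_pert[of "L - L0"] that assms(2) by (auto simp: simple_isolated_eigenvalue_def)
  then show ?thesis
    using analytic_pert_eigenvalue pert_eigenvalue_zero
    by (intro exI[of _ "\<lambda>L. pert_eigenvalue (L - L0)"]) auto
qed

end
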